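(* Let $n\ge1$, $\mu>0$ and $u,v\in\mathbb{R}$ with $|u|\ne|v|$. For every $(\lambda,e^{\mathrm{i}\theta})\in\mathcal{D}_+\times\mathbb{T}^n$, where $$\mathcal{D}_+=\{\lambda\in\mathbb{R}^n\mid\lambda_n>\max(|u|,|v|),\ \lambda_j-\lambda_{j+1}>\mu\ (j=1,\dots,n-1)\},$$ the Hamiltonian $H$ defined in the context is a limit of the van Diejen Hamiltonian $H_{\rm vD}$ defined in the context: $$H(\lambda,\theta)=e^{v-u}\lim_{\substack{a\to-\infty,\ b\to+\infty\\ c\to u,\ d\to v}}\Big(4e^{a}e^{-b}H_{\rm vD}[\mu;a,b,c,d](\lambda,\theta)\Big)+n .$$
   Context: The Hamiltonian $H$ on $\mathcal{D}_+\times\mathbb{T}^n$ is $$\begin{aligned}H(\lambda,\theta)=V(\lambda)+e^{v-u}\sum_{j=1}^n&\frac{\cos\theta_j}{\cosh^2\lambda_j}\Big[1-\frac{\sinh^2v}{\sinh^2\lambda_j}\Big]^{1/2}\Big[1-\frac{\sinh^2u}{\sinh^2\lambda_j}\Big]^{1/2}\\&\times\prod_{\substack{k=1\\k\ne j}}^n\Big[1-\frac{\sinh^2\mu}{\sinh^2(\lambda_j-\lambda_k)}\Big]^{1/2}\Big[1-\frac{\sinh^2\mu}{\sinh^2(\lambda_j+\lambda_k)}\Big]^{1/2},\end{aligned}$$ $$V(\lambda)=e^{v-u}\Big(\frac{\sinh v\sinh u}{\sinh^2\mu}\prod_{j=1}^n\Big[1-\frac{\sinh^2\mu}{\sinh^2\lambda_j}\Big]-\frac{\cosh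 v\cosh u}{\sinh^2\mu}\prod_{j=1}^n\Big[1+\frac{\sinh^2\mu}{\cosh^2\lambda_j}\Big]+C_0\Big),\qquad C_0=ne^{u-v}+\frac{\cosh(v-u)}{\sinh^2\mu}.$$ The (real form of the) van Diejen Hamiltonian with real parameters $\mu,a,b,c,d$ is $$H_{\rm vD}[\mu;a,b,c,d](\lambda,\theta)=\sum_{j=1}^n(\cos\theta_j)(V_jV_{-j})^{1/2}(\lambda)-\frac12\sum_{j=1}^n(V_j+V_{-j})(\lambda),$$ with $V_{\pm j}=V_{\pm j}^{(1)}V_{\pm j}^{(2)}$, $$V_{\pm j}^{(1)}(\lambda)=\frac{\cosh(a\pm\lambda_j)\cosh(b\pm\lambda_j)\sinh(c\pm\lambda_j)\sinh(d\pm\lambda_j)}{\cosh^2\lambda_j\,\sinh^2\lambda_j},$$ $$V_{\pm j}^{(2)}(\lambda)=\prod_{k\ne j}\frac{\sinh(\mu\pm(\lambda_j+\lambda_k))\,\sinh(\mu\pm(\lambda_j-\lambda_k))}{\sinh(\lambda_j+\lambda_k)\,\sinh(\lambda_j-\lambda_k)}.$$ For fixed $\lambda\in\mathcal{D}_+$ and $(c,d)$ close enough to $(u,v)$, $V_jV_{-j}(\lambda)>0$ and the positive square root is meant. *)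

theory Defs
  imports Complex_Main
begin

text \<open>
  A vector in \<open>\<real>\<^sup>n\<close> is a function \<^typ>\<open>nat \<Rightarrow> real\<close> of which only the values at
  \<open>1, \<dots>, n\<close> are used; a point \<open>(e\<^sup>i\<^sup>\<theta>\<^sup>1, \<dots>, e\<^sup>i\<^sup>\<theta>\<^sup>n)\<close> of the torus is given by real angles \<open>\<theta> j\<close>,
  on which the Hamiltonians depend only through \<open>cos (\<theta> j)\<close>.
\<close>

definition D_plus :: "nat \<Rightarrow> real \<Rightarrow> real \<Rightarrow> real \<Rightarrow> (nat \<Rightarrow> real) set" where
  "D_plus n \<mu> u v =
     {x. x n > max \<bar>u\<bar> \<bar>v\<bar> \<and> (\<forall>j\<in>{1..<n}. x j - x (Suc j) > \<mu>)}"

definition C0 :: "nat \<Rightarrow> real \<Rightarrow> real \<Rightarrow> real \<Rightarrow> real" where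
  "C0 n \<mu> u v = real n * exp (u - v) + cosh (v - u) / (sinh \<mu>)\<^sup>2"

definition potential :: "nat \<Rightarrow> real \<Rightarrow> real \<Rightarrow> real \<Rightarrow> (nat \<Rightarrow> real) \<Rightarrow> real" where
  "potential n \<mu> u v x =
     exp (v - u) *
       (sinh v * sinh u / (sinh \<mu>)\<^sup>2 * (\<Prod>j\<in>{1..n}. 1 - (sinh \<mu>)\<^sup>2 / (sinh (x j))\<^sup>2)
        - cosh v * cosh u / (sinh \<mu>)\<^sup>2 * (\<Prod>j\<in>{1..n}. 1 + (sinh \<mu>)\<^sup>2 / (cosh (x j))\<^sup>2)
        + C0 n \<mu> u v)"

definition Ham :: "nat \<Rightarrow> real \<Rightarrow> real \<Rightarrow> real \<Rightarrow> (nat \<Rightarrow> real) \<Rightarrow> (nat \<Rightarrow> real) \<Rightarrow> real" where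
  "Ham n \<mu> u v x \<theta> =
     potential n \<mu> u v x +
     exp (v - u) *
       (\<Sum>j\<in>{1..n}.
          cos (\<theta> j) / (cosh (x j))\<^sup>2
          * sqrt (1 - (sinh v)\<^sup>2 / (sinh (x j))\<^sup>2)
          * sqrt (1 - (sinh u)\<^sup>2 / (sinh (x j))\<^sup>2)
          * (\<Prod>k\<in>{1..n} - {j}.
               sqrt (1 - (sinh \<mu>)\<^sup>2 / (sinh (x j - x k))\<^sup>2)
               * sqrt (1 - (sinh \<mu>)\<^sup>2 / (sinh (x j + x k))\<^sup>2)))"

text \<open>
  The subscript \<open>\<plusminus>j\<close> of the van Diejen functions \<open>V\<^sub>\<plusminus>\<^sub>j\<close> is encoded by a sign
  \<open>s \<in> {1, -1}\<close> together with the index \<open>j\<close>.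
\<close>

definition vD_V1 ::
  "real \<Rightarrow> real \<Rightarrow> real \<Rightarrow> real \<Rightarrow> real \<Rightarrow> nat \<Rightarrow> (nat \<Rightarrow> real) \<Rightarrow> real" where
  "vD_V1 a b c d s j x =
     cosh (a + s * x j) * cosh (b + s * x j) * sinh (c + s * x j) * sinh (d + s * x j)
     / ((cosh (x j))\<^sup>2 * (sinh (x j))\<^sup>2)"

definition vD_V2 :: "nat \<Rightarrow> real \<Rightarrow> real \<Rightarrow> nat \<Rightarrow> (nat \<Rightarrow> real) \<Rightarrow> real" where
  "vD_V2 n \<mu> s j x =
     (\<Prod>k\<in>{1..n} - {j}.
        sinh (\<mu> + s * (x j + x k)) * sinh (\<mu> + s * (x j - x k))
        / (sinh (x j + x k) * sinh (x j - x k)))"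

definition vD_V ::
  "nat \<Rightarrow> real \<Rightarrow> real \<Rightarrow> real \<Rightarrow> real \<Rightarrow> real \<Rightarrow> real \<Rightarrow> nat \<Rightarrow> (nat \<Rightarrow> real) \<Rightarrow> real" where
  "vD_V n \<mu> a b c d s j x = vD_V1 a b c d s j x * vD_V2 n \<mu> s j x"

text \<open>
  For \<open>x \<in> D_plus n \<mu> u v\<close> and \<open>(c, d)\<close> close to \<open>(u, v)\<close> the argument of the square root
  below is positive; elsewhere the value of \<^const>\<open>sqrt\<close> at a negative number is irrelevant.
\<close>

definition Ham_vD ::
  "nat \<Rightarrow> real \<Rightarrow> real \<Rightarrow> real \<Rightarrow> real \<Rightarrow> real \<Rightarrow> (nat \<Rightarrow> real) \<Rightarrow> (nat \<Rightarrow> real) \<Rightarrow> real" where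
  "Ham_vD n \<mu> a b c d x \<theta> =
     (\<Sum>j\<in>{1..n}. cos (\<theta> j) * sqrt (vD_V n \<mu> a b c d 1 j x * vD_V n \<mu> a b c d (-1) j x))
     - 1 / 2 * (\<Sum>j\<in>{1..n}. vD_V n \<mu> a b c d 1 j x + vD_V n \<mu> a b c d (-1) j x)"

end

theory Submission
  imports Defs "HOL-Computational_Algebra.Polynomial"
begin

text \<open>
  As \<open>a \<rightarrow> -\<infinity>\<close> and \<open>b \<rightarrow> +\<infinity>\<close>, the factor \<open>4 e\<^sup>a e\<^sup>-\<^sup>b cosh (a + y) cosh (b + y)\<close> tends to \<open>1\<close>
  for every \<open>y\<close>, so the limit exists termwise and the terms with \<open>cos \<theta>\<^sub>j\<close> match immediately.
  What remains is to sum the limits \<open>W\<^sub>\<plusminus>\<^sub>j\<close> of \<open>4 e\<^sup>a e\<^sup>-\<^sup>b V\<^sub>\<plusminus>\<^sub>j\<close> in closed form. In the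
  variable \<open>w = e\<^sup>2\<^sup>y\<close> they are, up to a common constant, the residues at
  \<open>w = e\<^sup>\<plusminus>\<^sup>2\<^sup>x\<^sup>j\<close> of a rational function vanishing to second order at infinity. Its other poles are
  \<open>1\<close> and \<open>-1\<close>, which yield the two products in the potential, and \<open>\<plusminus>e\<^sup>-\<^sup>\<mu>\<close>, which together
  yield \<open>cosh (v - u)\<close>; the residues add up to zero. The poles are simple
  unless \<open>\<mu> = 2 x\<^sub>j\<close> for some \<open>j\<close>, and those values of \<open>\<mu>\<close> are reached by continuity.
\<close>

section \<open>Residue sums of rational functions with simple real poles\<close>

text \<open>Lagrange interpolation at \<open>N\<close> reproduces \<open>p\<close>, and comparing
  coefficients in degree \<open>card N - 1\<close> gives the sum: every cofactor \<open>R a\<close>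
  is monic of that degree, while \<open>p\<close> has smaller degree. Analytically, these are the
  residues of \<open>p\<close> over the nodal polynomial.\<close>

lemma lagrange_residue_sum:
  fixes p :: "real poly" and N :: "real set" and R :: "real \<Rightarrow> real poly"
  assumes "finite N" and deg: "degree p + 1 < card N"
    and R: "\<And>a. a \<in> N \<Longrightarrow> (\<Prod>b\<in>N. [:- b, 1:]) = [:- a, 1:] * R a"
  shows "(\<Sum>a\<in>N. poly p a / poly (R a) a) = 0"
proof -
  have R_eq: "R a = (\<Prod>b\<in>N - {a}. [:- b, 1:])" if "a \<in> N" for a
  proof -
    have "[:- a, 1:] * R a = [:- a, 1:] * (\<Prod>b\<in>N - {a}. [:- b, 1:])"
      using R[OF that] prod.remove[OF \<open>finite N\<close> that, of "\<lambda>b. [:- b, 1:]"] by simp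
    then show ?thesis by (simp only: mult_cancel_left) simp
  qed
  have degR: "degree (R a) = card N - 1" if "a \<in> N" for a
    unfolding R_eq[OF that] using that \<open>finite N\<close>
    by (subst degree_prod_eq_sum_degree) auto
  have leadR: "coeff (R a) (card N - 1) = 1" if "a \<in> N" for a
  proof -
    have "lead_coeff (R a) = 1"
      unfolding R_eq[OF that] lead_coeff_prod by simp
    then show ?thesis using degR[OF that] by simp
  qed
  have nz: "poly (R a) a \<noteq> 0" if "a \<in> N" for a
    unfolding R_eq[OF that] poly_prod using \<open>finite N\<close> by (auto simp: prod_zero_iff)
  have zero: "poly (R a) b = 0" if "a \<in> N" "b \<in> N" "b \<noteq> a" for a b
    unfolding R_eq[OF that(1)] poly_prod using \<open>finite N\<close> that by (auto simp: prod_zero_iff)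
  \<comment> \<open>The interpolation error: it vanishes on \<open>N\<close> and has degree below
    \<open>card N\<close>, which forces it to be zero.\<close>
  define d where "d = p - (\<Sum>a\<in>N. smult (poly p a / poly (R a) a) (R a))"
  have "degree (\<Sum>a\<in>N. smult (poly p a / poly (R a) a) (R a)) \<le> card N - 1"
    using degR \<open>finite N\<close> by (intro degree_sum_le) (auto intro: order.trans[OF degree_smult_le])
  then have "degree d \<le> card N - 1"
    unfolding d_def using deg by (intro degree_diff_le) auto
  \<comment> \<open>\<open>deg\<close> makes \<open>card N\<close> at least 2, so the truncated
    difference \<open>card N - 1\<close> is strictly below \<open>card N\<close>.\<close>
  then have degd: "degree d < card N"
    using deg by linarith
  have "poly d b = 0" if "b \<in> N" for b
  proof -
    have "(\<Sum>a\<in>N. poly p a / poly (R a) a * poly (R a) b) = poly p b / poly (R b) b * poly (R b) b"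
      using zero that \<open>finite N\<close>
      by (subst sum.remove[OF \<open>finite N\<close> that]) (auto intro!: sum.neutral)
    then show ?thesis
      unfolding d_def using nz[OF that] by (simp add: poly_sum)
  qed
  then have sub: "N \<subseteq> {b. poly d b = 0}" by auto
  have "d = 0"
  proof (rule ccontr)
    assume "d \<noteq> 0"
    then have "card N \<le> card {b. poly d b = 0}"
      using sub poly_roots_finite by (intro card_mono) auto
    also have "\<dots> \<le> degree d"
      using \<open>d \<noteq> 0\<close> by (rule card_poly_roots_bound)
    finally show False using degd by simp
  qed
  \<comment> \<open>The index is one above the largest degree that \<open>deg\<close> allows for
    \<open>p\<close>, so the left coefficient is zero.\<close>
  then have "coeff p (card N - 1) = coeff (\<Sum>a\<in>N. smult (poly p a / poly (R a) a) (R a)) (card N - 1)"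
    unfolding d_def by simp
  also have "\<dots> = (\<Sum>a\<in>N. poly p a / poly (R a) a)"
    using leadR by (simp add: coeff_sum)
  finally show ?thesis
    using deg by (simp add: coeff_eq_0)
qed

text \<open>The nodes are 1, -1, r, -r and the pairs \<open>e k\<close>, \<open>1 / e k\<close>;
  \<open>re\<close> keeps r apart from the reciprocals. \<open>T j w\<close> is the residue at
  either root w of the j-th quadratic, whose derivative there is \<open>w - 1 / w\<close>.\<close>

lemma residue_sum_reciprocal_nodes:
  fixes e :: "nat \<Rightarrow> real" and B :: "real poly" and q r :: real
  assumes "finite I" and inj: "inj_on e I" and e1: "\<And>k. k \<in> I \<Longrightarrow> e k > 1"
    and r: "0 < r" "r < 1" and re: "\<And>k. k \<in> I \<Longrightarrow> r * e k \<noteq> 1"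
    and degB: "degree B \<le> 2"
  defines "p \<equiv> B * (\<Prod>k\<in>I. [:1, - (e k + 1 / e k) * q, q\<^sup>2:])"
  defines "T \<equiv> \<lambda>j w. poly p w / ((w\<^sup>2 - 1) * (w\<^sup>2 - r\<^sup>2) * (w - 1 / w)
                       * (\<Prod>k\<in>I - {j}. w\<^sup>2 - (e k + 1 / e k) * w + 1))"
  defines "P \<equiv> \<lambda>w. \<Prod>k\<in>I. w\<^sup>2 - (e k + 1 / e k) * w + 1"
  shows "poly p 1 / (2 * (1 - r\<^sup>2) * P 1) - poly p (-1) / (2 * (1 - r\<^sup>2) * P (-1))
         + poly p r / ((r\<^sup>2 - 1) * (2 * r) * P r) - poly p (- r) / ((r\<^sup>2 - 1) * (2 * r) * P (- r))
         + (\<Sum>j\<in>I. T j (e j) + T j (1 / e j)) = 0"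
proof -
  define N1 where "N1 = {1, -1, r, - r}"
  define N2 where "N2 = e ` I"
  define N3 where "N3 = (\<lambda>k. 1 / e k) ` I"
  define N where "N = N1 \<union> (N2 \<union> N3)"
  define Q where "Q = (\<lambda>J. \<Prod>k\<in>J. [:1, - (e k + 1 / e k), 1:])"
  have inj3: "inj_on (\<lambda>k. 1 / e k) I"
    using inj by (simp add: inj_on_def)
  \<comment> \<open>\<open>N2\<close> lies above 1 and \<open>N3\<close> inside (0, 1) without r, so
    all \<open>4 + 2 * card I\<close> nodes are distinct.\<close>
  have N2_gt: "w > 1" if "w \<in> N2" for w
    using that e1 by (auto simp: N2_def)
  have N3_bd: "0 < w \<and> w < 1 \<and> w \<noteq> r" if wN: "w \<in> N3" for w
  proof -
    obtain k where k: "k \<in> I" "w = 1 / e k" using wN by (auto simp: N3_def)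
    show ?thesis using e1[OF k(1)] re[OF k(1)] unfolding k(2) by (auto simp: field_simps)
  qed
  have fin: "finite N1" "finite N2" "finite N3"
    using \<open>finite I\<close> by (auto simp: N1_def N2_def N3_def)
  have disj23: "N2 \<inter> N3 = {}"
    using N2_gt N3_bd by fastforce
  have disj1: "N1 \<inter> (N2 \<union> N3) = {}"
    using N2_gt N3_bd r by (fastforce simp: N1_def)
  have finN: "finite N" using fin by (simp add: N_def)
  have "card N1 = 4" using r by (simp add: N1_def)
  moreover have "card N2 = card I" "card N3 = card I"
    using inj inj3 by (simp_all add: N2_def N3_def card_image)
  ultimately have cardN: "card N = 4 + 2 * card I"
    unfolding N_def using fin disj23 disj1 by (simp add: card_Un_disjoint)
  have "degree (\<Prod>k\<in>I. [:1, - (e k + 1 / e k) * q, q\<^sup>2:]) \<le> (\<Sum>k\<in>I. 2)"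
    using \<open>finite I\<close> by (intro order.trans[OF degree_prod_sum_le] sum_mono) auto
  \<comment> \<open>The degree of \<open>p\<close> is at most \<open>2 + 2 * card I\<close>, two
    below the number of nodes.\<close>
  then have degp: "degree p + 1 < card N"
    unfolding p_def cardN using degB
    by (intro le_less_trans[OF add_right_mono[OF degree_mult_le]]) simp
  have prod1: "(\<Prod>b\<in>N1. [:- b, 1:]) = [:-1, 0, 1:] * [:- r\<^sup>2, 0, 1:]"
    using r by (simp add: N1_def power2_eq_square)
  have quad: "[:- e k, 1:] * [:- (1 / e k), 1:] = [:1, - (e k + 1 / e k), 1:]" if "k \<in> I" for k
    using e1[OF that] by simp
  have "(\<Prod>b\<in>N2 \<union> N3. [:- b, 1:]) = (\<Prod>b\<in>N2. [:- b, 1:]) * (\<Prod>b\<in>N3. [:- b, 1:])"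
    using fin disj23 by (simp add: prod.union_disjoint)
  also have "\<dots> = (\<Prod>k\<in>I. [:- e k, 1:] * [:- (1 / e k), 1:])"
    unfolding N2_def N3_def by (simp only: prod.reindex[OF inj] prod.reindex[OF inj3] prod.distrib o_def)
  also have "\<dots> = Q I"
    unfolding Q_def using quad by (intro prod.cong) auto
  finally have prodN: "(\<Prod>b\<in>N. [:- b, 1:]) = [:-1, 0, 1:] * [:- r\<^sup>2, 0, 1:] * Q I"
    unfolding N_def using fin disj1 prod1 by (simp add: prod.union_disjoint)
  define R where "R = (\<lambda>a. \<Prod>b\<in>N - {a}. [:- b, 1:])"
  have RN: "(\<Prod>b\<in>N. [:- b, 1:]) = [:- a, 1:] * R a" if "a \<in> N" for a
    unfolding R_def using finN that by (rule prod.remove)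
  \<comment> \<open>Any explicit factorization of the nodal polynomial through a node identifies the
    cofactor, so no product over \<open>N - {a}\<close> has to be evaluated.\<close>
  have R_unique: "R a = S" if "a \<in> N" "(\<Prod>b\<in>N. [:- b, 1:]) = [:- a, 1:] * S" for a S
  proof -
    have "[:- a, 1:] * R a = [:- a, 1:] * S" using RN[OF that(1)] that(2) by simp
    then show ?thesis by (simp only: mult_cancel_left) simp
  qed
  have polyQ: "poly (Q J) w = (\<Prod>k\<in>J. w\<^sup>2 - (e k + 1 / e k) * w + 1)" for J w
    unfolding Q_def poly_prod by (intro prod.cong) (auto simp: power2_eq_square algebra_simps)
  have PQ: "P w = poly (Q I) w" for w by (simp add: polyQ P_def)
  have in_N: "1 \<in> N" "-1 \<in> N" "r \<in> N" "- r \<in> N" by (auto simp: N_def N1_def)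
  have f1: "[:-1, 0, 1 :: real:] = [:-1, 1:] * [:1, 1:]" by simp
  have fr: "[:- r\<^sup>2, 0, 1:] = [:- r, 1:] * [:r, 1:]" by (simp add: power2_eq_square)
  have R1: "poly (R 1) 1 = 2 * (1 - r\<^sup>2) * P 1"
    by (subst R_unique[OF in_N(1), of "[:1, 1:] * [:- r\<^sup>2, 0, 1:] * Q I"])
       (simp_all only: prodN f1 mult_ac, simp_all add: PQ algebra_simps)
  have R2: "poly (R (-1)) (-1) = - (2 * (1 - r\<^sup>2) * P (-1))"
    by (subst R_unique[OF in_N(2), of "[:-1, 1:] * [:- r\<^sup>2, 0, 1:] * Q I"])
       (simp_all only: prodN f1 mult_ac minus_minus, simp_all add: PQ algebra_simps)
  have R3: "poly (R r) r = (r\<^sup>2 - 1) * (2 * r) * P r"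
    by (subst R_unique[OF in_N(3), of "[:-1, 0, 1:] * [:r, 1:] * Q I"])
       (simp_all only: prodN fr mult_ac, simp_all add: PQ power2_eq_square algebra_simps)
  have R4: "poly (R (- r)) (- r) = - ((r\<^sup>2 - 1) * (2 * r) * P (- r))"
    by (subst R_unique[OF in_N(4), of "[:-1, 0, 1:] * [:- r, 1:] * Q I"])
       (simp_all only: prodN fr mult_ac minus_minus, simp_all add: PQ power2_eq_square algebra_simps)
  have RT: "poly p w / poly (R w) w = T j w" if j: "j \<in> I" and w: "w = e j \<or> w = 1 / e j" for j w
  proof -
    have wN: "w \<in> N" using j w by (auto simp: N_def N2_def N3_def)
    have Q: "Q I = [:1, - (e j + 1 / e j), 1:] * Q (I - {j})"
      unfolding Q_def using \<open>finite I\<close> j by (rule prod.remove)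
    \<comment> \<open>The quadratic is symmetric under exchanging w and 1/w, so one factorization
      serves both roots.\<close>
    have "[:1, - (e j + 1 / e j), 1:] = [:- w, 1:] * [:- (1 / w), 1:]"
      using w e1[OF j] by auto
    then have Rw: "R w = [:-1, 0, 1:] * [:- r\<^sup>2, 0, 1:] * [:- (1 / w), 1:] * Q (I - {j})"
      by (intro R_unique[OF wN]) (simp only: prodN Q mult_ac)
    show ?thesis
      unfolding T_def Rw poly_mult polyQ by (simp add: power2_eq_square)
  qed
  have "0 = (\<Sum>a\<in>N. poly p a / poly (R a) a)"
    using lagrange_residue_sum[OF finN degp RN] by simp
  also have "\<dots> = (\<Sum>a\<in>N1. poly p a / poly (R a) a)
      + ((\<Sum>a\<in>N2. poly p a / poly (R a) a) + (\<Sum>a\<in>N3. poly p a / poly (R a) a))"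
    unfolding N_def using fin disj1 disj23 by (simp add: sum.union_disjoint)
  also have "(\<Sum>a\<in>N2. poly p a / poly (R a) a) = (\<Sum>j\<in>I. T j (e j))"
    unfolding N2_def sum.reindex[OF inj] using RT by (intro sum.cong) auto
  also have "(\<Sum>a\<in>N3. poly p a / poly (R a) a) = (\<Sum>j\<in>I. T j (1 / e j))"
    unfolding N3_def sum.reindex[OF inj3] using RT by (intro sum.cong) auto
  also have "(\<Sum>a\<in>N1. poly p a / poly (R a) a)
     = poly p 1 / poly (R 1) 1 + poly p (-1) / poly (R (-1)) (-1)
       + poly p r / poly (R r) r + poly p (- r) / poly (R (- r)) (- r)"
    using r by (simp add: N1_def)
  finally show ?thesis
    unfolding R1 R2 R3 R4 by (simp add: sum.distrib)
qed

section \<open>Closed form of the summed limits\<close>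

text \<open>The left side is (e^(2y) - e^(2t)) (e^(2y) - e^(-2t)), and each factor is an exponential
  times a hyperbolic sine. This translates the nodal quadratics into the products in
  \<open>vD_V2\<close>.\<close>

lemma exp_double_factor:
  fixes y t :: real
  shows "(exp (2 * y))\<^sup>2 - (exp (2 * t) + 1 / exp (2 * t)) * exp (2 * y) + 1
         = 4 * exp (2 * y) * (sinh (y + t) * sinh (y - t))"
  unfolding sinh_field_def exp_add exp_diff exp_minus exp_double by (simp add: field_simps power2_eq_square)

lemma prod_ratio:
  fixes f g h :: "'a \<Rightarrow> real"
  assumes "\<And>k. k \<in> J \<Longrightarrow> g k \<noteq> 0 \<and> f k = q * h k * g k"
  shows "(\<Prod>k\<in>J. f k) / (\<Prod>k\<in>J. g k) = q ^ card J * (\<Prod>k\<in>J. h k)"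
proof -
  have "(\<Prod>k\<in>J. f k) / (\<Prod>k\<in>J. g k) = (\<Prod>k\<in>J. f k / g k)"
    by (rule prod_dividef [symmetric])
  also have "\<dots> = (\<Prod>k\<in>J. q * h k)"
    using assms by (intro prod.cong) auto
  finally show ?thesis
    by (simp add: prod.distrib)
qed

text \<open>The limit W of the rescaled V: the scaling absorbs the two \<open>cosh\<close> factors,
  and c, d have become u, v.\<close>

definition vD_limit :: "nat \<Rightarrow> real \<Rightarrow> real \<Rightarrow> real \<Rightarrow> real \<Rightarrow> nat \<Rightarrow> (nat \<Rightarrow> real) \<Rightarrow> real" where
  "vD_limit n \<mu> u v s j x =
     sinh (u + s * x j) * sinh (v + s * x j) / ((cosh (x j))\<^sup>2 * (sinh (x j))\<^sup>2) * vD_V2 n \<mu> s j x"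

text \<open>The vanishing residue sum with \<open>e k\<close> = e^(2 x k), r = e^(-\<mu>) and q =
  e^(2 \<mu>), normalized by \<open>c\<close>. The assumption \<open>gen\<close> says that r is none
  of the \<open>1 / e k\<close>, so that all poles are simple.\<close>

lemma sum_vD_limit_generic:
  fixes n :: nat and \<mu> u v :: real and x :: "nat \<Rightarrow> real"
  assumes "\<mu> > 0" and inj: "inj_on x {1..n}" and pos: "\<And>k. k \<in> {1..n} \<Longrightarrow> x k > 0"
    and gen: "\<And>k. k \<in> {1..n} \<Longrightarrow> 2 * x k \<noteq> \<mu>"
  shows "(sinh \<mu>)\<^sup>2 / 2 * (\<Sum>j\<in>{1..n}. vD_limit n \<mu> u v 1 j x + vD_limit n \<mu> u v (-1) j x)
         + sinh u * sinh v * (\<Prod>j\<in>{1..n}. 1 - (sinh \<mu>)\<^sup>2 / (sinh (x j))\<^sup>2)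
         - cosh u * cosh v * (\<Prod>j\<in>{1..n}. 1 + (sinh \<mu>)\<^sup>2 / (cosh (x j))\<^sup>2)
         + cosh (u - v) = 0"
proof -
  define e where "e = (\<lambda>k. exp (2 * x k))"
  define r q where "r = exp (- \<mu>)" and "q = exp (2 * \<mu>)"
  \<comment> \<open>Chosen so that \<open>poly B\<close> at e^(2y) is a multiple of
    \<open>sinh (u + y) * sinh (v + y)\<close>; it carries all dependence on u and v.\<close>
  define B where "B = [:exp (- u - v), - (exp (u - v) + exp (v - u)), exp (u + v):]"
  define p where "p = B * (\<Prod>k\<in>{1..n}. [:1, - (e k + 1 / e k) * q, q\<^sup>2:])"
  define P where "P = (\<lambda>w. \<Prod>k\<in>{1..n}. w\<^sup>2 - (e k + 1 / e k) * w + 1)"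
  define T where "T = (\<lambda>j w. poly p w / ((w\<^sup>2 - 1) * (w\<^sup>2 - r\<^sup>2) * (w - 1 / w)
                       * (\<Prod>k\<in>{1..n} - {j}. w\<^sup>2 - (e k + 1 / e k) * w + 1)))"
  \<comment> \<open>Each residue \<open>T j\<close> contains \<open>q ^ n\<close>, one q per
    quadratic, and a single \<open>sinh \<mu>\<close>; \<open>1 - r^2 = 2 * r * sinh \<mu>\<close>
    supplies the second one.\<close>
  define c where "c = (1 - r\<^sup>2) / (2 * q ^ n)"
  have r: "0 < r" "r < 1" using \<open>\<mu> > 0\<close> by (auto simp: r_def)
  then have r2: "r\<^sup>2 < 1" by (simp add: power_less_one_iff)
  have qr: "q = 1 / r\<^sup>2" and q: "q > 0"
    unfolding q_def r_def exp_double exp_minus by (simp_all add: field_simps)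
  have inj_e: "inj_on e {1..n}"
    unfolding e_def by (rule inj_onI) (use inj in \<open>simp add: inj_on_eq_iff\<close>)
  have e1: "e k > 1" if "k \<in> {1..n}" for k
    using pos[OF that] by (simp add: e_def)
  have re: "r * e k \<noteq> 1" if "k \<in> {1..n}" for k
    using gen[OF that] by (simp add: r_def e_def flip: exp_add)
  have degB: "degree B \<le> 2" by (simp add: B_def)
  have "poly p 1 / (2 * (1 - r\<^sup>2) * P 1) - poly p (-1) / (2 * (1 - r\<^sup>2) * P (-1))
         + poly p r / ((r\<^sup>2 - 1) * (2 * r) * P r) - poly p (- r) / ((r\<^sup>2 - 1) * (2 * r) * P (- r))
         + (\<Sum>j\<in>{1..n}. T j (e j) + T j (1 / e j)) = 0"
    unfolding P_def T_def p_def
    by (rule residue_sum_reciprocal_nodes) (use inj_e e1 r re degB in auto)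
  then have res: "poly p 1 / P 1 / (2 * (1 - r\<^sup>2)) - poly p (-1) / P (-1) / (2 * (1 - r\<^sup>2))
      + poly p r / P r / ((r\<^sup>2 - 1) * (2 * r)) - poly p (- r) / P (- r) / ((r\<^sup>2 - 1) * (2 * r))
      + (\<Sum>j\<in>{1..n}. T j (e j) + T j (1 / e j)) = 0"
    by (simp only: divide_divide_eq_left mult_ac)
  have poly_p: "poly p w = poly B w * (\<Prod>k\<in>{1..n}. (q * w)\<^sup>2 - (e k + 1 / e k) * (q * w) + 1)" for w
    unfolding p_def poly_mult poly_prod
    by (intro arg_cong2[of _ _ _ _ "(*)"] prod.cong) (auto simp: power2_eq_square algebra_simps)
  have B_exp: "poly B (exp (2 * y)) = 4 * exp (2 * y) * (sinh (u + y) * sinh (v + y))" for y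
    unfolding B_def sinh_field_def exp_add exp_diff exp_minus exp_double by (simp add: field_simps power2_eq_square)
  have quad_nz: "w\<^sup>2 - (e k + 1 / e k) * w + 1 \<noteq> 0" if "k \<in> {1..n}" "w \<noteq> e k" "w \<noteq> 1 / e k" for k w
  proof -
    have "w\<^sup>2 - (e k + 1 / e k) * w + 1 = (w - e k) * (w - 1 / e k)"
      using e1[OF that(1)] by (simp add: power2_eq_square field_simps)
    then show ?thesis using that by simp
  qed
  have q_exp: "q * exp (2 * y) = exp (2 * (\<mu> + y))" for y
    by (simp add: q_def exp_add distrib_left)
  have factor: "w\<^sup>2 - (e k + 1 / e k) * w + 1 = 4 * w * (sinh (y + x k) * sinh (y - x k))"
    if "w = exp (2 * y)" for w y k
    unfolding that e_def by (rule exp_double_factor)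
  have T_eq: "c * T j (exp (2 * (s * x j))) = (sinh \<mu>)\<^sup>2 / 2 * vD_limit n \<mu> u v s j x"
    if j: "j \<in> {1..n}" and s: "s = 1 \<or> s = -1" for j s
  proof -
    define y where "y = s * x j"
    define w where "w = exp (2 * y)"
    have w0: "w > 0" by (simp add: w_def)
    have qw: "q * w = exp (2 * (\<mu> + y))" unfolding w_def by (rule q_exp)
    have A0: "sinh (\<mu> + 2 * y) \<noteq> 0"
      using s gen[OF j] pos[OF j] \<open>\<mu> > 0\<close> by (auto simp: y_def)
    have D0: "sinh (2 * y) \<noteq> 0"
      using s pos[OF j] by (auto simp: y_def)
    \<comment> \<open>The numerator factor with k = j yields \<open>sinh (\<mu> + 2 * y)\<close>,
      which has no counterpart in \<open>vD_V2\<close>. It cancels against \<open>w^2 - r^2\<close>,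
      which is why the poles at r and -r are introduced.\<close>
    have num_j: "(q * w)\<^sup>2 - (e j + 1 / e j) * (q * w) + 1 = 4 * (q * w) * (sinh (\<mu> + 2 * y) * sinh \<mu>)"
      unfolding factor[OF qw] using s by (auto simp: y_def algebra_simps)
    have ratio: "(\<Prod>k\<in>{1..n} - {j}. (q * w)\<^sup>2 - (e k + 1 / e k) * (q * w) + 1)
        / (\<Prod>k\<in>{1..n} - {j}. w\<^sup>2 - (e k + 1 / e k) * w + 1)
        = q ^ card ({1..n} - {j}) * vD_V2 n \<mu> s j x"
      unfolding vD_V2_def
    proof (rule prod_ratio)
      fix k assume k: "k \<in> {1..n} - {j}"
      have "x j \<noteq> x k" using k j inj by (auto simp: inj_on_eq_iff)
      then have nz: "sinh (x j + x k) \<noteq> 0" "sinh (x j - x k) \<noteq> 0"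
        using k pos[OF j] pos[of k] by auto
      \<comment> \<open>For s = -1 the two factors are swapped and both change sign, so the product
        is the same.\<close>
      have 1: "sinh (y + x k) * sinh (y - x k) = sinh (x j + x k) * sinh (x j - x k)"
      proof (cases "s = 1")
        case False
        then have "y + x k = - (x j - x k)" "y - x k = - (x j + x k)"
          using s by (auto simp: y_def)
        then show ?thesis by (simp only: sinh_minus) simp
      qed (simp add: y_def)
      have 2: "sinh (\<mu> + y + x k) * sinh (\<mu> + y - x k)
          = sinh (\<mu> + s * (x j + x k)) * sinh (\<mu> + s * (x j - x k))"
        using s by (auto simp: y_def algebra_simps)
      show "w\<^sup>2 - (e k + 1 / e k) * w + 1 \<noteq> 0 \<and>
         (q * w)\<^sup>2 - (e k + 1 / e k) * (q * w) + 1
         = q * (sinh (\<mu> + s * (x j + x k)) * sinh (\<mu> + s * (x j - x k))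
                / (sinh (x j + x k) * sinh (x j - x k)))
             * (w\<^sup>2 - (e k + 1 / e k) * w + 1)"
        using nz w0 q unfolding factor[OF w_def] factor[OF qw] 1 2
        by simp
    qed
    \<comment> \<open>The nodes 1, -1 and the derivative of the j-th quadratic give one factor
      \<open>sinh (2 * y)\<close> each; together they produce the denominator of
      \<open>vD_limit\<close>.\<close>
    have den: "w\<^sup>2 - 1 = 2 * w * sinh (2 * y)" "w - 1 / w = 2 * sinh (2 * y)"
      "w\<^sup>2 - r\<^sup>2 = 2 * w * r * sinh (\<mu> + 2 * y)"
      unfolding w_def r_def sinh_field_def exp_add exp_diff exp_minus exp_double by (simp_all add: field_simps power2_eq_square)
    have r2_eq: "1 - r\<^sup>2 = 2 * r * sinh \<mu>"
      unfolding r_def sinh_field_def exp_add exp_diff exp_minus exp_double by (simp add: field_simps power2_eq_square)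
    have D_sq: "(sinh (2 * y))\<^sup>2 = 4 * ((cosh (x j))\<^sup>2 * (sinh (x j))\<^sup>2)"
      using s by (auto simp: y_def sinh_double power_mult_distrib)
    have q_pow: "q ^ n = q * q ^ card ({1..n} - {j})"
      using j by (simp add: power_eq_if)
    define M N where "M = (\<Prod>k\<in>{1..n} - {j}. (q * w)\<^sup>2 - (e k + 1 / e k) * (q * w) + 1)"
      and "N = (\<Prod>k\<in>{1..n} - {j}. w\<^sup>2 - (e k + 1 / e k) * w + 1)"
    have "poly p w = 4 * w * (sinh (u + y) * sinh (v + y)) * (4 * (q * w) * (sinh (\<mu> + 2 * y) * sinh \<mu>) * M)"
      unfolding poly_p M_def using j B_exp[of y]
      by (subst prod.remove[of _ j]) (simp_all add: num_j flip: w_def)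
    then have "T j w = 2 * q * (sinh (u + y) * sinh (v + y)) * sinh \<mu> / (r * (sinh (2 * y))\<^sup>2) * (M / N)"
      unfolding T_def den N_def[symmetric] using A0 D0 w0 r by (simp add: power2_eq_square mult_ac)
    also have "M / N = q ^ card ({1..n} - {j}) * vD_V2 n \<mu> s j x"
      unfolding M_def N_def by (rule ratio)
    finally show ?thesis
      unfolding c_def vD_limit_def r2_eq q_pow D_sq
      using q r by (simp add: power2_eq_square flip: w_def y_def)
  qed
  have sum_T: "c * (\<Sum>j\<in>{1..n}. T j (e j) + T j (1 / e j))
      = (sinh \<mu>)\<^sup>2 / 2 * (\<Sum>j\<in>{1..n}. vD_limit n \<mu> u v 1 j x + vD_limit n \<mu> u v (-1) j x)"
    unfolding sum_distrib_left
  proof (rule sum.cong[OF refl])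
    fix j assume j: "j \<in> {1..n}"
    have "1 / e j = exp (2 * (- 1 * x j))" "e j = exp (2 * (1 * x j))"
      by (simp_all add: e_def exp_minus field_simps)
    then show "c * (T j (e j) + T j (1 / e j))
        = (sinh \<mu>)\<^sup>2 / 2 * (vD_limit n \<mu> u v 1 j x + vD_limit n \<mu> u v (-1) j x)"
      using T_eq[OF j, of 1] T_eq[OF j, of "-1"] by (simp only: distrib_left simp_thms)
  qed
  have ratio: "poly p w / P w = poly B w * (q ^ n * (\<Prod>k\<in>{1..n}. h k))"
    if "\<And>k. k \<in> {1..n} \<Longrightarrow> w\<^sup>2 - (e k + 1 / e k) * w + 1 \<noteq> 0 \<and>
       (q * w)\<^sup>2 - (e k + 1 / e k) * (q * w) + 1 = q * h k * (w\<^sup>2 - (e k + 1 / e k) * w + 1)" for w h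
    unfolding poly_p P_def times_divide_eq_right[symmetric] by (subst prod_ratio[OF that]) simp_all
  have e_cosh: "e k + 1 / e k = 2 + 4 * (sinh (x k))\<^sup>2" for k
    unfolding e_def sinh_field_def exp_add exp_diff exp_minus exp_double by (simp add: field_simps power2_eq_square)
  have q_sinh: "q\<^sup>2 = q * (2 + 4 * (sinh \<mu>)\<^sup>2) - 1"
    unfolding q_def sinh_field_def exp_add exp_diff exp_minus exp_double by (simp add: field_simps power2_eq_square)
  have at_1: "poly p 1 / P 1
      = 4 * (sinh u * sinh v) * (q ^ n * (\<Prod>k\<in>{1..n}. 1 - (sinh \<mu>)\<^sup>2 / (sinh (x k))\<^sup>2))"
  proof -
    have "(q * 1)\<^sup>2 - (e k + 1 / e k) * (q * 1) + 1
        = q * (1 - (sinh \<mu>)\<^sup>2 / (sinh (x k))\<^sup>2) * (1\<^sup>2 - (e k + 1 / e k) * 1 + 1)"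
      if "k \<in> {1..n}" for k
      using pos[OF that] unfolding e_cosh by (simp add: q_sinh field_simps)
    moreover have "1\<^sup>2 - (e k + 1 / e k) * 1 + 1 \<noteq> 0" if "k \<in> {1..n}" for k
      using e1[OF that] by (intro quad_nz[OF that]) (auto simp: field_simps)
    ultimately show ?thesis
      using B_exp[of 0] ratio[of 1 "\<lambda>k. 1 - (sinh \<mu>)\<^sup>2 / (sinh (x k))\<^sup>2"] by simp
  qed
  have at_m1: "poly p (-1) / P (-1)
      = 4 * (cosh u * cosh v) * (q ^ n * (\<Prod>k\<in>{1..n}. 1 + (sinh \<mu>)\<^sup>2 / (cosh (x k))\<^sup>2))"
  proof -
    have e_cosh': "e k + 1 / e k = 4 * (cosh (x k))\<^sup>2 - 2" for k
      unfolding e_cosh cosh_square_eq by simp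
    have "(q * (-1))\<^sup>2 - (e k + 1 / e k) * (q * (-1)) + 1
        = q * (1 + (sinh \<mu>)\<^sup>2 / (cosh (x k))\<^sup>2) * ((-1)\<^sup>2 - (e k + 1 / e k) * (-1) + 1)"
      if "k \<in> {1..n}" for k
      unfolding e_cosh' by (simp add: q_sinh field_simps)
    moreover have "poly B (-1) = 4 * (cosh u * cosh v)"
      unfolding B_def cosh_field_def exp_add exp_diff exp_minus exp_double by (simp add: field_simps power2_eq_square)
    moreover have "(-1)\<^sup>2 - (e k + 1 / e k) * (-1) + 1 \<noteq> 0" if "k \<in> {1..n}" for k
      using e1[OF that] by (intro quad_nz[OF that]) (auto simp: field_simps)
    ultimately show ?thesis
      using ratio[of "-1" "\<lambda>k. 1 + (sinh \<mu>)\<^sup>2 / (cosh (x k))\<^sup>2"] by simp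
  qed
  \<comment> \<open>For w = r or w = -r one has q w = 1/w, and the quadratics are palindromic, so
    every ratio equals q and the products collapse.\<close>
  have at_r: "poly p w / P w = poly B w * q ^ n" if w: "w = r \<or> w = - r" for w
  proof -
    have "(q * w)\<^sup>2 - (e k + 1 / e k) * (q * w) + 1
        = q * 1 * (w\<^sup>2 - (e k + 1 / e k) * w + 1)" for k
      using w r unfolding qr by (auto simp: field_simps power2_eq_square)
    moreover have "w \<noteq> e k \<and> w \<noteq> 1 / e k" if "k \<in> {1..n}" for k
    proof -
      have "r * e k > 0" using r e1[OF that] by simp
      then have "w * e k \<noteq> 1" "w < 1"
        using w r re[OF that] by auto
      then show ?thesis
        using e1[OF that] by (auto simp: field_simps)
    qed
    ultimately have "poly p w / P w = poly B w * (q ^ n * (\<Prod>k\<in>{1..n}. 1))"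
      using quad_nz by (intro ratio) blast
    then show ?thesis by simp
  qed
  \<comment> \<open>The residues at r and -r enter with opposite signs, so only the linear
    coefficient of \<open>B\<close> survives.\<close>
  have B_r: "poly B (- r) - poly B r = 4 * r * cosh (u - v)"
    unfolding B_def cosh_field_def exp_add exp_diff exp_minus exp_double by (simp add: field_simps power2_eq_square)
  have "0 = c * (poly p 1 / P 1 / (2 * (1 - r\<^sup>2)) - poly p (-1) / P (-1) / (2 * (1 - r\<^sup>2))
      + poly p r / P r / ((r\<^sup>2 - 1) * (2 * r)) - poly p (- r) / P (- r) / ((r\<^sup>2 - 1) * (2 * r)))
      + c * (\<Sum>j\<in>{1..n}. T j (e j) + T j (1 / e j))"
    using res by (simp only: distrib_left[symmetric] mult_zero_right)
  also have "c * (poly p 1 / P 1 / (2 * (1 - r\<^sup>2)) - poly p (-1) / P (-1) / (2 * (1 - r\<^sup>2))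
      + poly p r / P r / ((r\<^sup>2 - 1) * (2 * r)) - poly p (- r) / P (- r) / ((r\<^sup>2 - 1) * (2 * r)))
     = sinh u * sinh v * (\<Prod>k\<in>{1..n}. 1 - (sinh \<mu>)\<^sup>2 / (sinh (x k))\<^sup>2)
       - cosh u * cosh v * (\<Prod>k\<in>{1..n}. 1 + (sinh \<mu>)\<^sup>2 / (cosh (x k))\<^sup>2) + (poly B (- r) - poly B r) / (4 * r)"
  proof -
    \<comment> \<open>Here d stands for \<open>1 - r^2\<close>, Q for \<open>q ^ n\<close>, X and Y
      for the two products, b1 and b2 for the values of \<open>B\<close> at r and -r.\<close>
    have collect: "d / (2 * Q) * (4 * s * (Q * X) / (2 * d) - 4 * t * (Q * Y) / (2 * d)
        + b1 * Q / (- d * (2 * r)) - b2 * Q / (- d * (2 * r))) = s * X - t * Y + (b2 - b1) / (4 * r)"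
      if "d \<noteq> 0" "Q \<noteq> 0" for d Q X Y s t b1 b2
      using that r by (simp add: field_simps)
    have "r\<^sup>2 - 1 = - (1 - r\<^sup>2)" by simp
    then show ?thesis
      unfolding at_1 at_m1 at_r[OF disjI1[OF refl]] at_r[OF disjI2[OF refl]] c_def
      using q r2 by (simp only:) (rule collect, auto)
  qed
  finally show ?thesis
    unfolding sum_T B_r using r by simp
qed

text \<open>With x fixed, the left side is continuous in \<mu>. The assumptions on x do not involve
  \<mu>, so the generic identity applies at all positive values except finitely many, and uniqueness
  of limits gives it at \<mu>.\<close>

lemma sum_vD_limit:
  fixes n :: nat and \<mu> u v :: real and x :: "nat \<Rightarrow> real"
  assumes "\<mu> > 0" and inj: "inj_on x {1..n}" and pos: "\<And>k. k \<in> {1..n} \<Longrightarrow> x k > 0"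
  shows "(sinh \<mu>)\<^sup>2 / 2 * (\<Sum>j\<in>{1..n}. vD_limit n \<mu> u v 1 j x + vD_limit n \<mu> u v (-1) j x)
         + sinh u * sinh v * (\<Prod>j\<in>{1..n}. 1 - (sinh \<mu>)\<^sup>2 / (sinh (x j))\<^sup>2)
         - cosh u * cosh v * (\<Prod>j\<in>{1..n}. 1 + (sinh \<mu>)\<^sup>2 / (cosh (x j))\<^sup>2)
         + cosh (u - v) = 0" (is "?F \<mu> = 0")
proof -
  have nz: "sinh (x j + x k) \<noteq> 0 \<and> sinh (x j - x k) \<noteq> 0"
    if "j \<in> {1..n}" "k \<in> {1..n} - {j}" for j k
  proof -
    have "x j \<noteq> x k" using that inj by (auto simp: inj_on_eq_iff)
    then show ?thesis using pos[of j] pos[of k] that by auto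
  qed
  have lim_V2: "(\<lambda>m. vD_V2 n m s j x) \<midarrow>\<mu>\<rightarrow> vD_V2 n \<mu> s j x" if "j \<in> {1..n}" for s j
    unfolding vD_V2_def by (intro tendsto_intros) (use nz[OF that] in simp)
  have lim: "?F \<midarrow>\<mu>\<rightarrow> ?F \<mu>"
    unfolding vD_limit_def divide_inverse
    by (intro tendsto_add tendsto_diff tendsto_mult tendsto_sum tendsto_prod tendsto_const
        tendsto_power tendsto_sinh tendsto_ident_at lim_V2)
  have "\<forall>\<^sub>F m in at \<mu>. m > 0"
    using \<open>\<mu> > 0\<close> by (rule order_tendstoD[OF tendsto_ident_at])
  \<comment> \<open>The filter \<open>at \<mu>\<close> omits \<mu> itself, so this holds even when
    \<mu> is one of the values \<open>2 * x k\<close>.\<close>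
  moreover have "\<forall>\<^sub>F m in at \<mu>. \<forall>k\<in>{1..n}. m \<noteq> 2 * x k"
    by (intro eventually_ball_finite ballI eventually_neq_at_within) simp
  ultimately have "\<forall>\<^sub>F m in at \<mu>. ?F m = 0"
  proof eventually_elim
    case (elim m)
    show ?case
      by (rule sum_vD_limit_generic[OF elim(1) inj pos]) (use elim(2) in auto)
  qed
  then have "?F \<midarrow>\<mu>\<rightarrow> 0"
    by (rule tendsto_eventually)
  with lim show ?thesis
    by (rule LIM_unique)
qed

section \<open>Ordering on the domain and limits of the rescaled functions\<close>

lemma D_plus_less:
  assumes "x \<in> D_plus n \<mu> u v" "\<mu> > 0" "1 \<le> i" "i < j" "j \<le> n"
  shows "x j < x i"
  using \<open>i < j\<close> \<open>j \<le> n\<close>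
proof (induction j)
  case (Suc j)
  have "\<forall>k\<in>{1..<n}. x k - x (Suc k) > \<mu>"
    using assms(1) by (simp add: D_plus_def)
  from bspec[OF this, of j] have "x (Suc j) < x j"
    using assms(2,3) Suc.prems by simp
  then show ?case
    using Suc by (cases "i = j") auto
qed simp

text \<open>The product expands to e^(2a) e^y + e^(-y), whose first term dies.\<close>

lemma tendsto_cosh_exp_at_bot: "((\<lambda>a :: real. exp a * (2 * cosh (a + y))) \<longlongrightarrow> exp (- y)) at_bot"
proof -
  have "((\<lambda>a :: real. (exp a)\<^sup>2 * exp y + exp (- y)) \<longlongrightarrow> 0\<^sup>2 * exp y + exp (- y)) at_bot"
    by (intro tendsto_intros exp_at_bot)
  moreover have "exp a * (2 * cosh (a + y)) = (exp a)\<^sup>2 * exp y + exp (- y)" for a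
    unfolding cosh_field_def exp_add exp_minus by (simp add: field_simps power2_eq_square)
  ultimately show ?thesis by simp
qed

lemma tendsto_cosh_exp_at_top: "((\<lambda>b :: real. exp (- b) * (2 * cosh (b + y))) \<longlongrightarrow> exp y) at_top"
proof -
  have "((\<lambda>b :: real. exp (- b) * (2 * cosh (- b + - y))) \<longlongrightarrow> exp (- (- y))) at_top"
    by (rule filterlim_compose[OF tendsto_cosh_exp_at_bot filterlim_uminus_at_bot_at_top])
  moreover have "cosh (- b + - y) = cosh (b + y)" for b
    using cosh_minus[of "b + y"] by simp
  ultimately show ?thesis by (simp only: minus_minus)
qed

text \<open>The constant 4 is split as 2 * 2 between the two \<open>cosh\<close> factors, whose
  limits e^(-y) and e^y cancel. The product filter makes this a joint limit in four independent
  parameters.\<close>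

lemma tendsto_vD_V:
  "((\<lambda>(a, b, c, d). 4 * exp a * exp (- b) * vD_V n \<mu> a b c d s j x) \<longlongrightarrow> vD_limit n \<mu> u v s j x)
     (at_bot \<times>\<^sub>F at_top \<times>\<^sub>F nhds u \<times>\<^sub>F nhds v)"
proof -
  let ?F = "(at_bot :: real filter) \<times>\<^sub>F (at_top :: real filter) \<times>\<^sub>F nhds u \<times>\<^sub>F nhds v"
  let ?y = "s * x j"
  have a: "filterlim fst at_bot ?F" and p: "filterlim snd (at_top \<times>\<^sub>F nhds u \<times>\<^sub>F nhds v) ?F"
    by (simp_all add: filterlim_def filtermap_fst_prod_filter filtermap_snd_prod_filter)
  have b: "filterlim (\<lambda>t. fst (snd t)) at_top ?F"
    and q: "filterlim (\<lambda>t. snd (snd t)) (nhds u \<times>\<^sub>F nhds v) ?F"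
    by (rule filterlim_compose[OF _ p];
        simp add: filterlim_def filtermap_fst_prod_filter filtermap_snd_prod_filter)+
  have c: "((\<lambda>t. fst (snd (snd t))) \<longlongrightarrow> u) ?F" and d: "((\<lambda>t. snd (snd (snd t))) \<longlongrightarrow> v) ?F"
    by (rule filterlim_compose[OF _ q];
        simp add: filterlim_def filtermap_fst_prod_filter filtermap_snd_prod_filter)+
  have "((\<lambda>t. (exp (fst t) * (2 * cosh (fst t + ?y)))
        * (exp (- fst (snd t)) * (2 * cosh (fst (snd t) + ?y)))
        * (sinh (fst (snd (snd t)) + ?y) * sinh (snd (snd (snd t)) + ?y)
           / ((cosh (x j))\<^sup>2 * (sinh (x j))\<^sup>2) * vD_V2 n \<mu> s j x))
      \<longlongrightarrow> (exp (- ?y) * exp ?y) * vD_limit n \<mu> u v s j x) ?F"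
    unfolding vD_limit_def divide_inverse
    by (intro tendsto_mult tendsto_const tendsto_sinh tendsto_add c d
        filterlim_compose[OF tendsto_cosh_exp_at_bot a] filterlim_compose[OF tendsto_cosh_exp_at_top b])
  moreover have "exp (- ?y) * exp ?y = 1"
    by (simp flip: exp_add)
  ultimately show ?thesis
    by (simp add: case_prod_unfold vD_V_def vD_V1_def mult.assoc mult.left_commute)
qed

section \<open>Square roots in the cosine terms\<close>

lemma sinh_add_mult_sinh_diff:
  fixes t y :: real
  shows "sinh (t + y) * sinh (t - y) = (sinh t)\<^sup>2 - (sinh y)\<^sup>2"
proof -
  have "sinh (t + y) * sinh (t - y) = (sinh t)\<^sup>2 * (cosh y)\<^sup>2 - (cosh t)\<^sup>2 * (sinh y)\<^sup>2"
    by (simp add: sinh_add sinh_diff power2_eq_square algebra_simps)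
  then show ?thesis
    unfolding cosh_square_eq by (simp add: algebra_simps)
qed

text \<open>Multiplying W for j and -j pairs \<open>sinh (t + y)\<close> with
  \<open>sinh (t - y)\<close>, and each pair over \<open>sinh y\<close> squared is, up to sign, one
  bracket of the Hamiltonian.\<close>

lemma sqrt_vD_limit:
  assumes j: "j \<in> {1..n}" and inj: "inj_on x {1..n}" and pos: "\<And>k. k \<in> {1..n} \<Longrightarrow> x k > 0"
  shows "sqrt (vD_limit n \<mu> u v 1 j x * vD_limit n \<mu> u v (-1) j x)
     = 1 / (cosh (x j))\<^sup>2
          * sqrt (1 - (sinh v)\<^sup>2 / (sinh (x j))\<^sup>2)
          * sqrt (1 - (sinh u)\<^sup>2 / (sinh (x j))\<^sup>2)
          * (\<Prod>k\<in>{1..n} - {j}.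
               sqrt (1 - (sinh \<mu>)\<^sup>2 / (sinh (x j - x k))\<^sup>2)
               * sqrt (1 - (sinh \<mu>)\<^sup>2 / (sinh (x j + x k))\<^sup>2))"
proof -
  have sqrt_prod: "sqrt (\<Prod>k\<in>J. f k) = (\<Prod>k\<in>J. sqrt (f k))" for f and J :: "nat set"
    by (induction J rule: infinite_finite_induct) (simp_all add: real_sqrt_mult)
  \<comment> \<open>The minus signs cancel in pairs: one from each of u and v, and two for every
    k.\<close>
  have quot: "sinh (t + y) * sinh (t - y) / (sinh y)\<^sup>2 = - (1 - (sinh t)\<^sup>2 / (sinh y)\<^sup>2)"
    if "sinh y \<noteq> 0" for t y :: real
    unfolding sinh_add_mult_sinh_diff using that by (simp add: diff_divide_distrib)
  have V2: "vD_V2 n \<mu> 1 j x * vD_V2 n \<mu> (-1) j x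
    = (\<Prod>k\<in>{1..n} - {j}. (1 - (sinh \<mu>)\<^sup>2 / (sinh (x j - x k))\<^sup>2) * (1 - (sinh \<mu>)\<^sup>2 / (sinh (x j + x k))\<^sup>2))"
    unfolding vD_V2_def prod.distrib[symmetric]
  proof (rule prod.cong[OF refl])
    fix k assume k: "k \<in> {1..n} - {j}"
    have "x j \<noteq> x k" using j k inj by (auto simp: inj_on_eq_iff)
    then have nz: "sinh (x j + x k) \<noteq> 0" "sinh (x j - x k) \<noteq> 0"
      using pos[of j] pos[of k] j k by auto
    have "sinh (\<mu> + 1 * (x j + x k)) * sinh (\<mu> + 1 * (x j - x k)) / (sinh (x j + x k) * sinh (x j - x k))
        * (sinh (\<mu> + (-1) * (x j + x k)) * sinh (\<mu> + (-1) * (x j - x k)) / (sinh (x j + x k) * sinh (x j - x k)))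
      = (sinh (\<mu> + (x j - x k)) * sinh (\<mu> - (x j - x k)) / (sinh (x j - x k))\<^sup>2)
        * (sinh (\<mu> + (x j + x k)) * sinh (\<mu> - (x j + x k)) / (sinh (x j + x k))\<^sup>2)"
      by (simp only: mult_1 mult_minus1 add_uminus_conv_diff times_divide_times_eq power2_eq_square mult_ac)
    then show "sinh (\<mu> + 1 * (x j + x k)) * sinh (\<mu> + 1 * (x j - x k)) / (sinh (x j + x k) * sinh (x j - x k))
        * (sinh (\<mu> + (-1) * (x j + x k)) * sinh (\<mu> + (-1) * (x j - x k)) / (sinh (x j + x k) * sinh (x j - x k)))
      = (1 - (sinh \<mu>)\<^sup>2 / (sinh (x j - x k))\<^sup>2) * (1 - (sinh \<mu>)\<^sup>2 / (sinh (x j + x k))\<^sup>2)"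
      unfolding quot[OF nz(1)] quot[OF nz(2)] minus_mult_minus .
  qed
  have nz: "sinh (x j) \<noteq> 0" using pos[OF j] by auto
  have "vD_limit n \<mu> u v 1 j x * vD_limit n \<mu> u v (-1) j x
     = (1 / (cosh (x j))\<^sup>2)\<^sup>2 * (sinh (v + x j) * sinh (v - x j) / (sinh (x j))\<^sup>2)
         * (sinh (u + x j) * sinh (u - x j) / (sinh (x j))\<^sup>2)
         * (vD_V2 n \<mu> 1 j x * vD_V2 n \<mu> (-1) j x)"
    by (simp add: vD_limit_def power2_eq_square mult_ac)
  then have "vD_limit n \<mu> u v 1 j x * vD_limit n \<mu> u v (-1) j x
     = (1 / (cosh (x j))\<^sup>2)\<^sup>2 * (1 - (sinh v)\<^sup>2 / (sinh (x j))\<^sup>2) * (1 - (sinh u)\<^sup>2 / (sinh (x j))\<^sup>2)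
         * (vD_V2 n \<mu> 1 j x * vD_V2 n \<mu> (-1) j x)"
    unfolding quot[OF nz] by (simp only: mult_minus_left mult_minus_right minus_minus)
  \<comment> \<open>The real \<open>sqrt\<close> is odd and hence multiplicative for all signs, so
    the product splits factor by factor.\<close>
  then show ?thesis
    unfolding V2 by (simp only: real_sqrt_mult sqrt_prod real_sqrt_abs abs_power2 abs_divide abs_one)
qed

section \<open>Assembling the limit of the Hamiltonian\<close>

theorem propositionB1:
  fixes n :: nat and \<mu> u v :: real and x \<theta> :: "nat \<Rightarrow> real"
  assumes "n \<ge> 1" and "\<mu> > 0" and "\<bar>u\<bar> \<noteq> \<bar>v\<bar>"
    and "x \<in> D_plus n \<mu> u v"
  shows "\<exists>L. ((\<lambda>(a, b, c, d). 4 * exp a * exp (- b) * Ham_vD n \<mu> a b c d x \<theta>) \<longlongrightarrow> L)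
               (at_bot \<times>\<^sub>F at_top \<times>\<^sub>F nhds u \<times>\<^sub>F nhds v)
           \<and> Ham n \<mu> u v x \<theta> = exp (v - u) * L + real n"
proof -
  let ?F = "(at_bot :: real filter) \<times>\<^sub>F (at_top :: real filter) \<times>\<^sub>F nhds u \<times>\<^sub>F nhds v"
  let ?W = "\<lambda>s j. vD_limit n \<mu> u v s j x"
  have less: "x k < x i" if "1 \<le> i" "i < k" "k \<le> n" for i k
    using D_plus_less[OF assms(4,2) that] .
  have pos: "x k > 0" if "k \<in> {1..n}" for k
  proof -
    have "x n > 0" using assms(4) by (auto simp: D_plus_def)
    moreover have "x n \<le> x k" using less[of k n] that by (cases "k = n") auto
    ultimately show ?thesis by simp
  qed
  have inj: "inj_on x {1..n}"
    by (rule linorder_inj_onI) (use less in fastforce)+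
  define L where "L = (\<Sum>j\<in>{1..n}. cos (\<theta> j) * sqrt (?W 1 j * ?W (-1) j))
      - 1 / 2 * (\<Sum>j\<in>{1..n}. ?W 1 j + ?W (-1) j)"
  define V where "V = (\<lambda>s j (a, b, c, d). 4 * exp a * exp (- b) * vD_V n \<mu> a b c d s j x)"
  have lim_V: "(V s j \<longlongrightarrow> ?W s j) ?F" for s j
    unfolding V_def by (rule tendsto_vD_V)
  \<comment> \<open>\<open>sqrt\<close> is continuous on all of \<real>, so the limit passes under
    the root term by term.\<close>
  have "((\<lambda>t. (\<Sum>j\<in>{1..n}. cos (\<theta> j) * sqrt (V 1 j t * V (-1) j t))
      - 1 / 2 * (\<Sum>j\<in>{1..n}. V 1 j t + V (-1) j t)) \<longlongrightarrow> L) ?F"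
    unfolding L_def by (intro tendsto_intros lim_V)
  also have "(\<lambda>t. (\<Sum>j\<in>{1..n}. cos (\<theta> j) * sqrt (V 1 j t * V (-1) j t))
      - 1 / 2 * (\<Sum>j\<in>{1..n}. V 1 j t + V (-1) j t))
      = (\<lambda>(a, b, c, d). 4 * exp a * exp (- b) * Ham_vD n \<mu> a b c d x \<theta>)"
  proof (rule ext, clarsimp)
    fix a b c d :: real
    define K where "K = 4 * exp a * exp (- b)"
    \<comment> \<open>Nonnegativity turns the root of K^2 into K, so the scaling of both V under the
      root becomes one factor K.\<close>
    have "K \<ge> 0" by (simp add: K_def)
    then have "sqrt (K * y * (K * z)) = K * sqrt (y * z)" for y z
      by (simp add: real_sqrt_mult)
    moreover have "V s j (a, b, c, d) = K * vD_V n \<mu> a b c d s j x" for s j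
      by (simp add: V_def K_def)
    ultimately show "(\<Sum>j = Suc 0..n. cos (\<theta> j) * sqrt (V 1 j (a, b, c, d) * V (- 1) j (a, b, c, d)))
        - (\<Sum>j = Suc 0..n. V 1 j (a, b, c, d) + V (- 1) j (a, b, c, d)) / 2
        = 4 * exp a * exp (- b) * Ham_vD n \<mu> a b c d x \<theta>"
      unfolding Ham_vD_def K_def[symmetric]
      by (simp add: right_diff_distrib sum_distrib_left distrib_left mult.left_commute
          sum_divide_distrib add_divide_distrib)
  qed
  finally have "((\<lambda>(a, b, c, d). 4 * exp a * exp (- b) * Ham_vD n \<mu> a b c d x \<theta>) \<longlongrightarrow> L) ?F" .
  moreover have "Ham n \<mu> u v x \<theta> = exp (v - u) * L + real n"
  proof -
    define X Y where "X = (\<Prod>j\<in>{1..n}. 1 - (sinh \<mu>)\<^sup>2 / (sinh (x j))\<^sup>2)"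
      and "Y = (\<Prod>j\<in>{1..n}. 1 + (sinh \<mu>)\<^sup>2 / (cosh (x j))\<^sup>2)"
    have "sinh \<mu> \<noteq> 0" using assms(2) by simp
    moreover have cosh_diff_commute: "cosh (v - u) = cosh (u - v)"
      using cosh_minus[of "u - v"] unfolding minus_diff_eq .
    \<comment> \<open>The closed form divided by \<open>sinh \<mu>\<close> squared; its last term is
      one of the two summands of \<open>C0\<close>.\<close>
    ultimately have "- (1 / 2 * (\<Sum>j\<in>{1..n}. ?W 1 j + ?W (-1) j))
        = sinh v * sinh u / (sinh \<mu>)\<^sup>2 * X - cosh v * cosh u / (sinh \<mu>)\<^sup>2 * Y + cosh (v - u) / (sinh \<mu>)\<^sup>2"
      using sum_vD_limit[OF assms(2) inj pos, of u v, folded X_def Y_def]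
      unfolding cosh_diff_commute by (simp add: field_simps)
    \<comment> \<open>The other summand of \<open>C0\<close> accounts for the additive n.\<close>
    moreover have "exp (v - u) * (real n * exp (u - v)) = real n"
      by (simp add: exp_diff)
    ultimately have "potential n \<mu> u v x = exp (v - u) * - (1 / 2 * (\<Sum>j\<in>{1..n}. ?W 1 j + ?W (-1) j)) + real n"
      unfolding potential_def C0_def X_def[symmetric] Y_def[symmetric] by (simp add: distrib_left)
    moreover have "(\<Sum>j\<in>{1..n}. cos (\<theta> j) * sqrt (?W 1 j * ?W (-1) j))
      = (\<Sum>j\<in>{1..n}.
          cos (\<theta> j) / (cosh (x j))\<^sup>2
          * sqrt (1 - (sinh v)\<^sup>2 / (sinh (x j))\<^sup>2)
          * sqrt (1 - (sinh u)\<^sup>2 / (sinh (x j))\<^sup>2)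
          * (\<Prod>k\<in>{1..n} - {j}.
               sqrt (1 - (sinh \<mu>)\<^sup>2 / (sinh (x j - x k))\<^sup>2)
               * sqrt (1 - (sinh \<mu>)\<^sup>2 / (sinh (x j + x k))\<^sup>2)))"
    proof (intro sum.cong refl, goal_cases)
      case (1 j)
      show ?case by (subst sqrt_vD_limit[OF 1 inj pos]) simp_all
    qed
    ultimately show ?thesis
      unfolding Ham_def L_def by (simp add: algebra_simps)
  qed
  ultimately show ?thesis by blast
qed

end
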